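(* Let $n\ge 1$. For each $T\in\mathcal{T}_n$, the distance $dist(T_0,T)$ between $T_0$ and $T$ in the tableau graph $\Gamma^{\mathcal{T}_n}$ equals the number of inversions of the permutation $\sigma_T$.
   Context: $\mathcal{T}_n$ is the set of standard Young tableaux of shape $(n,n)$ ($2\times n$ fillings with $1,\dots,2n$, increasing along rows and down columns). $s_i\in S_{2n}$ is the transposition of $i$ and $i+1$, and $s_i\cdot T$ is obtained from $T$ by swapping the entries $i$ and $i+1$. Tableau graph $\Gamma^{\mathcal{T}_n}$: directed graph with vertex set $\mathcal{T}_n$ and an edge $T\stackrel{s_i}{\longrightarrow}T'$ iff $s_i\cdot T=T'$ and $i$ is in the second row and $i+1$ in the first row of $T$. $T_0\in\mathcal{T}_n$ has top row $1,3,\dots,2n-1$ and bottom row $2,4,\dots,2n$. The distance $dist(T_0,T)$ is the length (number of edges) of a shortest directed path from $T_0$ to $T$ in $\Gamma^{\mathcal{T}_n}$. $\sigma_T$ is the permutation of $\{1,\dots,2n\}$ whose one-line notation is obtained by reading the entries of $T$ down each column, from the leftmost to the rightmost column. The number of inversions of a permutation in one-line notation is the number of pairs of entries $\cdots i\cdots j\cdots$ with $i$ to the left of $j$ and $i>j$. *)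

theory Defs
  imports "Graph_Theory.Arc_Walk" "HOL-Combinatorics.Permutations" "HOL-Library.Extended_Nat"
begin

(* A two-row filling is the pair (first row, second row), each row listed from left to right. *)
type_synonym tableau = "nat list \<times> nat list"

definition SYT :: "nat \<Rightarrow> tableau set" where
  "SYT n = {(a, b). length a = n \<and> length b = n \<and>
     distinct (a @ b) \<and> set (a @ b) = {1..2 * n} \<and>
     sorted_wrt (<) a \<and> sorted_wrt (<) b \<and> (\<forall>j<n. a ! j < b ! j)}"

definition swap_entries :: "nat \<Rightarrow> tableau \<Rightarrow> tableau" where
  "swap_entries i T = (map (transpose i (i + 1)) (fst T), map (transpose i (i + 1)) (snd T))"

(* The triple (T, i, T') is the edge from T to T' labelled by the transposition of i and i + 1. *)
definition tableau_graph :: "nat \<Rightarrow> (tableau, tableau \<times> nat \<times> tableau) pre_digraph" where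
  "tableau_graph n =
     \<lparr>verts = SYT n,
      arcs = {(T, i, T'). T \<in> SYT n \<and> T' \<in> SYT n \<and> i \<in> {1..<2 * n} \<and>
                swap_entries i T = T' \<and> i \<in> set (snd T) \<and> i + 1 \<in> set (fst T)},
      tail = (\<lambda>(T, i, T'). T),
      head = (\<lambda>(T, i, T'). T')\<rparr>"

(* The infimum over the empty set is \<infinity>, so unreachable vertices are at infinite distance. *)
definition digraph_dist :: "('a, 'b) pre_digraph \<Rightarrow> 'a \<Rightarrow> 'a \<Rightarrow> enat" where
  "digraph_dist G u v = (INF p \<in> {p. pre_digraph.apath G u p v}. enat (length p))"

definition T0 :: "nat \<Rightarrow> tableau" where
  "T0 n = (map (\<lambda>j. 2 * j + 1) [0..<n], map (\<lambda>j. 2 * j + 2) [0..<n])"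

definition column_reading :: "tableau \<Rightarrow> nat list" where
  "column_reading T = concat (map2 (\<lambda>a b. [a, b]) (fst T) (snd T))"

(* One-line notation is indexed from 1, lists from 0; outside {1..2n} the function is the identity. *)
definition sigma :: "nat \<Rightarrow> tableau \<Rightarrow> nat \<Rightarrow> nat" where
  "sigma n T k = (if k \<in> {1..2 * n} then column_reading T ! (k - 1) else k)"

definition num_inversions :: "nat \<Rightarrow> (nat \<Rightarrow> nat) \<Rightarrow> nat" where
  "num_inversions m p = card {(k, l). 1 \<le> k \<and> k < l \<and> l \<le> m \<and> p k > p l}"

lemma wf_tableau_graph: "wf_digraph (tableau_graph n)"
  by unfold_locales (auto simp: tableau_graph_def)

lemma mset_column_reading:
  "length (fst T) = length (snd T) \<Longrightarrow> mset (column_reading T) = mset (fst T @ snd T)"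
proof -
  have "length a = length b \<Longrightarrow>
      mset (concat (map2 (\<lambda>x y. [x, y]) a b)) = mset (a @ b)" for a b :: "nat list"
    by (induction a b rule: list_induct2) auto
  then show "length (fst T) = length (snd T) \<Longrightarrow> ?thesis"
    by (simp add: column_reading_def)
qed

lemma sigma_permutes:
  assumes "T \<in> SYT n"
  shows "sigma n T permutes {1..2 * n}"
proof -
  let ?w = "column_reading T"
  have T: "length (fst T) = n" "length (snd T) = n" "distinct (fst T @ snd T)"
    "set (fst T @ snd T) = {1..2 * n}"
    using assms by (auto simp: SYT_def)
  have m: "mset ?w = mset (fst T @ snd T)"
    using T by (intro mset_column_reading) simp
  have len: "length ?w = 2 * n" using mset_eq_length[OF m] T by simp
  have dist: "distinct ?w" using mset_eq_imp_distinct_iff[OF m] T by simp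
  have set: "set ?w = {1..2 * n}" using mset_eq_setD[OF m] T by simp
  have inj: "inj_on (sigma n T) {1..2 * n}"
    using dist len by (auto simp: inj_on_def sigma_def nth_eq_iff_index_eq)
  have "sigma n T ` {1..2 * n} \<subseteq> {1..2 * n}"
  proof
    fix y assume "y \<in> sigma n T ` {1..2 * n}"
    then obtain k where "k \<in> {1..2 * n}" "y = ?w ! (k - 1)" by (auto simp: sigma_def)
    then have "y \<in> set ?w" using len by (auto intro!: nth_mem)
    then show "y \<in> {1..2 * n}" using set by simp
  qed
  then have "sigma n T ` {1..2 * n} = {1..2 * n}"
    using inj by (simp add: endo_inj_surj)
  then have "bij_betw (sigma n T) {1..2 * n} {1..2 * n}"
    using inj by (simp add: bij_betw_def)
  then show ?thesis
    by (rule bij_imp_permutes) (auto simp: sigma_def)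
qed

lemma T0_in_SYT: "T0 n \<in> SYT n"
proof -
  have "set (fst (T0 n) @ snd (T0 n)) = {1..2 * n}"
  proof (intro equalityI subsetI)
    fix x assume x: "x \<in> {1..2 * n}"
    show "x \<in> set (fst (T0 n) @ snd (T0 n))"
    proof (cases "even x")
      case True
      then have "x = 2 * (x div 2 - 1) + 2" "x div 2 - 1 < n" using x by (auto elim!: evenE)
      then show ?thesis unfolding T0_def by auto
    next
      case False
      then have "x = 2 * (x div 2) + 1" "x div 2 < n" using x by (auto elim!: oddE)
      then show ?thesis unfolding T0_def by auto
    qed
  qed (auto simp: T0_def)
  moreover have "distinct (fst (T0 n) @ snd (T0 n))"
    by (auto simp: T0_def distinct_map inj_on_def) presburger
  ultimately show ?thesis
    by (auto simp: SYT_def T0_def sorted_wrt_map sorted_wrt_iff_nth_less)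
qed

end

theory Submission
  imports Defs
begin

text \<open>
  The sum of the first row of a tableau is a potential for the tableau graph. An edge labelled
  \<open>i\<close> replaces \<open>i + 1\<close> by \<open>i\<close> in the first row, so it lowers this sum by exactly one
  (\<open>top_sum_arc\<close>). Hence all walks between two given vertices have the same length, and the
  distance from \<open>T0\<close> to \<open>T\<close>, if finite, is the drop of the potential. Two facts remain.

  The potential measures inversions: inversions plus first-row sum is always \<open>n\<^sup>2\<close>
  (\<open>num_inversions_plus_top_sum\<close>). Rows and columns increase, so an inversion of the column
  reading is always a second-row entry standing in an earlier column than a smaller first-row
  entry \<open>a ! k\<close>. Since \<open>a ! k\<close> is the number of entries that are at most \<open>a ! k\<close>, it equals
  \<open>k + 1\<close> plus the number of smaller second-row entries. Those lie in the \<open>k\<close> columns to the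
  left, and the remaining second-row entries of these columns are the inversions with \<open>a ! k\<close>.
  So \<open>a ! k\<close> plus the number of its inversions is \<open>2 * k + 1\<close>, and summing the first \<open>n\<close> odd
  numbers gives \<open>n\<^sup>2\<close>.

  Every tableau is reachable from \<open>T0\<close>: a tableau other than \<open>T0\<close> has an incoming edge
  (\<open>ex_arc_into\<close>), whose source has one inversion fewer, so that walking backwards ends at
  \<open>T0\<close>.
\<close>

section \<open>Inversions of the column reading\<close>

lemma nth_concat_map2_pairs:
  assumes "length xs = length ys" "j < length xs"
  shows "concat (map2 (\<lambda>x y. [x, y]) xs ys) ! (2 * j) = xs ! j"
    and "concat (map2 (\<lambda>x y. [x, y]) xs ys) ! (2 * j + 1) = ys ! j"
  using assms
proof (induction xs ys arbitrary: j rule: list_induct2)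
  case (Cons x xs y ys)
  {
    case 1
    with Cons.IH show ?case by (cases j) auto
  next
    case 2
    with Cons.IH show ?case by (cases j) auto
  }
qed auto

lemma sigma_odd_even:
  assumes "(a, b) \<in> SYT n" "j < n"
  shows "sigma n (a, b) (2 * j + 1) = a ! j" and "sigma n (a, b) (2 * j + 2) = b ! j"
  using assms nth_concat_map2_pairs[of a b j]
  by (auto simp: sigma_def column_reading_def SYT_def)

lemma SYT_nth_mono:
  assumes "(a, b) \<in> SYT n" "j \<le> k" "k < n"
  shows "a ! j \<le> a ! k" and "b ! j \<le> b ! k" and "a ! j < b ! k"
proof -
  show ab: "a ! j \<le> a ! k" "b ! j \<le> b ! k"
    using assms by (auto simp: SYT_def sorted_wrt_iff_nth_less le_less)
  show "a ! j < b ! k" using ab(1) assms by (force simp: SYT_def)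
qed

lemma card_le_nth_strict_sorted:
  fixes xs :: "nat list"
  assumes "sorted_wrt (<) xs" "k < length xs"
  shows "card (set xs \<inter> {..xs ! k}) = k + 1"
proof -
  have le: "xs ! j \<le> xs ! k \<longleftrightarrow> j \<le> k" if "j < length xs" for j
    using that assms sorted_wrt_nth_less[OF assms(1), of j k]
      sorted_wrt_nth_less[OF assms(1), of k j] by (cases j k rule: linorder_cases) auto
  have "set xs \<inter> {..xs ! k} = (\<lambda>j. xs ! j) ` {j. j < length xs \<and> xs ! j \<le> xs ! k}"
    by (auto simp: in_set_conv_nth)
  also have "{j. j < length xs \<and> xs ! j \<le> xs ! k} = {..k}"
    using le assms(2) by auto
  finally have "set xs \<inter> {..xs ! k} = (\<lambda>j. xs ! j) ` {..k}" .
  moreover have "inj_on (\<lambda>j. xs ! j) {..k}"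
    using assms by (auto simp: inj_on_def nth_eq_iff_index_eq strict_sorted_iff)
  ultimately show ?thesis by (simp add: card_image)
qed

text \<open>
  The entries \<open>1, \<dots>, a ! k\<close> are the first \<open>k + 1\<close> entries of the first row together with the
  second-row entries smaller than \<open>a ! k\<close>, all of which lie in columns left of \<open>k\<close>. The two kinds of
  second-row entries in these columns, smaller and larger than \<open>a ! k\<close>, number \<open>k\<close> in total.
\<close>
lemma top_entry_plus_inversions:
  assumes T: "(a, b) \<in> SYT n" and k: "k < n"
  shows "card {j. j < k \<and> a ! k < b ! j} + a ! k = 2 * k + 1"
proof -
  have ab: "length a = n" "length b = n" "distinct (a @ b)" "set (a @ b) = {1..2 * n}"
      "sorted_wrt (<) a" "sorted_wrt (<) b"
    using T by (auto simp: SYT_def)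
  let ?S = "{j. j < k \<and> b ! j < a ! k}"
  have ak: "a ! k \<in> set a" using ab k by simp
  have "{1..a ! k} = (set a \<inter> {..a ! k}) \<union> (set b \<inter> {..a ! k})"
  proof -
    have "a ! k \<le> 2 * n" using ab(4) ak by auto
    then have "{1..a ! k} = {1..2 * n} \<inter> {..a ! k}" by auto
    also have "\<dots> = (set a \<inter> {..a ! k}) \<union> (set b \<inter> {..a ! k})"
      unfolding ab(4)[symmetric] by auto
    finally show ?thesis .
  qed
  moreover have "(set a \<inter> {..a ! k}) \<inter> (set b \<inter> {..a ! k}) = {}"
    using ab(3) by auto
  ultimately have "card {1..a ! k} = card (set a \<inter> {..a ! k}) + card (set b \<inter> {..a ! k})"
    using card_Un_disjoint[of "set a \<inter> {..a ! k}" "set b \<inter> {..a ! k}"] by simp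
  then have "a ! k = card (set a \<inter> {..a ! k}) + card (set b \<inter> {..a ! k})"
    by simp
  also have "card (set a \<inter> {..a ! k}) = k + 1"
    using card_le_nth_strict_sorted ab k by auto
  also have "set b \<inter> {..a ! k} = (\<lambda>j. b ! j) ` ?S"
  proof (intro equalityI subsetI)
    fix x assume x: "x \<in> set b \<inter> {..a ! k}"
    then obtain j where j: "j < n" "x = b ! j" using ab by (auto simp: in_set_conv_nth)
    have "x \<noteq> a ! k" using x ak ab(3) by auto
    then have "b ! j < a ! k" using x j by auto
    moreover have "j < k"
      using SYT_nth_mono(3)[OF T, of k j] j calculation by (meson leI less_asym)
    ultimately show "x \<in> (\<lambda>j. b ! j) ` ?S" using j by auto
  qed (use ab k in auto)
  also have "card ((\<lambda>j. b ! j) ` ?S) = card ?S"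
    using ab k by (intro card_image) (auto simp: inj_on_def nth_eq_iff_index_eq)
  finally have entry: "a ! k = k + 1 + card ?S" .
  have ne: "b ! j \<noteq> a ! k" if "j < k" for j
  proof -
    have "b ! j \<in> set b" using that ab k by simp
    then show ?thesis using ab(3) ak by auto
  qed
  have "card {j. j < k \<and> a ! k < b ! j} + card ?S = card ({j. j < k \<and> a ! k < b ! j} \<union> ?S)"
    by (intro card_Un_disjoint[symmetric]) auto
  also have "{j. j < k \<and> a ! k < b ! j} \<union> ?S = {..<k}"
    using ne by (auto simp: neq_iff)
  finally show ?thesis using entry by simp
qed

text \<open>
  Of two entries in the reading, the earlier one can only be the larger if it is in the second row
  and the later one is in the first row: in the three other cases the earlier entry lies weakly
  above and to the left of the later one.
\<close>
lemma num_inversions_by_column: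
  assumes T: "(a, b) \<in> SYT n"
  shows "num_inversions (2 * n) (sigma n (a, b)) = (\<Sum>k<n. card {j. j < k \<and> a ! k < b ! j})"
proof -
  let ?s = "sigma n (a, b)"
  let ?A = "SIGMA k:{..<n}. {j. j < k \<and> a ! k < b ! j}"
  let ?f = "\<lambda>(k, j). (2 * j + 2, 2 * k + 1) :: nat \<times> nat"
  have "{(p, q). 1 \<le> p \<and> p < q \<and> q \<le> 2 * n \<and> ?s p > ?s q} = ?f ` ?A"
  proof (intro equalityI subsetI)
    fix x assume "x \<in> {(p, q). 1 \<le> p \<and> p < q \<and> q \<le> 2 * n \<and> ?s p > ?s q}"
    then obtain p q where x: "x = (p, q)" and pq: "1 \<le> p" "p < q" "q \<le> 2 * n" "?s q < ?s p"
      by auto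
    \<comment> \<open>position \<open>2 * j + 1\<close> holds the top and \<open>2 * j + 2\<close> the bottom entry of column \<open>j\<close>\<close>
    have pos: "\<exists>j<n. r = 2 * j + 1 \<or> r = 2 * j + 2" if "1 \<le> r" "r \<le> 2 * n" for r
      using that by presburger
    obtain j k where jk: "j < n" "p = 2 * j + 1 \<or> p = 2 * j + 2"
        "k < n" "q = 2 * k + 1 \<or> q = 2 * k + 2"
      using pos[of p] pos[of q] pq by auto
    then have "j \<le> k" using pq by auto
    then have "p = 2 * j + 2" "q = 2 * k + 1" "j < k"
      using jk pq SYT_nth_mono[OF T \<open>j \<le> k\<close> \<open>k < n\<close>] sigma_odd_even[OF T] by fastforce+
    then show "x \<in> ?f ` ?A"
      using x jk pq sigma_odd_even[OF T] by (auto intro!: image_eqI[of _ _ "(k, j)"])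
  next
    fix x assume "x \<in> ?f ` ?A"
    then show "x \<in> {(p, q). 1 \<le> p \<and> p < q \<and> q \<le> 2 * n \<and> ?s p > ?s q}"
      using sigma_odd_even[OF T] by auto
  qed
  then have "num_inversions (2 * n) ?s = card (?f ` ?A)"
    by (simp add: num_inversions_def)
  also have "\<dots> = card ?A"
    by (intro card_image) (auto simp: inj_on_def)
  finally show ?thesis by simp
qed

lemma num_inversions_plus_top_sum:
  assumes T: "T \<in> SYT n"
  shows "num_inversions (2 * n) (sigma n T) + sum_list (fst T) = n\<^sup>2"
proof -
  obtain a b where ab: "T = (a, b)" by (cases T)
  have "sum_list a = (\<Sum>k<n. a ! k)"
    using T ab by (auto simp: SYT_def sum_list_sum_nth atLeast0LessThan)
  then have "num_inversions (2 * n) (sigma n T) + sum_list (fst T)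
      = (\<Sum>k<n. card {j. j < k \<and> a ! k < b ! j} + a ! k)"
    using num_inversions_by_column T ab by (simp add: sum.distrib)
  also have "\<dots> = (\<Sum>k<n. 2 * k + 1)"
    using top_entry_plus_inversions T ab by simp
  also have "\<dots> = n\<^sup>2"
    by (induction n) (auto simp: power2_eq_square)
  finally show ?thesis .
qed

section \<open>The first-row sum along edges and walks\<close>

lemma count_list_distinct: "distinct xs \<Longrightarrow> count_list xs x = (if x \<in> set xs then 1 else 0)"
  by (induction xs) auto

text \<open>
  Occurrences of \<open>i + 1\<close> each lose one and occurrences of \<open>i\<close> each gain one; adding the counts on
  opposite sides avoids truncated subtraction.
\<close>
lemma sum_list_map_transpose_Suc:
  fixes xs :: "nat list"
  shows "sum_list (map (transpose i (i + 1)) xs) + count_list xs (i + 1)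
    = sum_list xs + count_list xs i"
  by (induction xs) (auto simp: transpose_def)

lemma tableau_graph_simps [simp]:
  "verts (tableau_graph n) = SYT n"
  "tail (tableau_graph n) (T, i, T') = T"
  "head (tableau_graph n) (T, i, T') = T'"
  by (simp_all add: tableau_graph_def)

lemma top_sum_arc:
  assumes "(T, i, T') \<in> arcs (tableau_graph n)"
  shows "sum_list (fst T') + 1 = sum_list (fst T)"
proof -
  have T: "T \<in> SYT n" "swap_entries i T = T'" "i \<in> set (snd T)" "i + 1 \<in> set (fst T)"
    using assms by (auto simp: tableau_graph_def)
  then have "distinct (fst T)" "i \<notin> set (fst T)"
    by (auto simp: SYT_def)
  then have "count_list (fst T) (i + 1) = 1" "count_list (fst T) i = 0"
    using T by (simp_all add: count_list_distinct)
  then show ?thesis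
    using sum_list_map_transpose_Suc[of i "fst T"] T by (auto simp: swap_entries_def)
qed

lemma top_sum_awalk:
  assumes "pre_digraph.awalk (tableau_graph n) S p T"
  shows "sum_list (fst T) + length p = sum_list (fst S)"
proof -
  interpret wf_digraph "tableau_graph n" by (rule wf_tableau_graph)
  show ?thesis using assms
  proof (induction p arbitrary: S)
    case Nil
    then show ?case by (simp add: awalk_Nil_iff)
  next
    case (Cons e p)
    obtain U i V where e: "e = (U, i, V)" by (cases e)
    with Cons.prems have "e \<in> arcs (tableau_graph n)" "S = U" "awalk V p T"
      by (auto simp: awalk_Cons_iff)
    then show ?case using Cons.IH[of V] top_sum_arc[of U i V n] e by auto
  qed
qed

section \<open>Reachability from the initial tableau\<close>

text \<open>
  An adjacent transposition reverses the order of the two swapped numbers only. Both the row and the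
  column conditions of a tableau therefore survive the swap unless \<open>i\<close> and \<open>i + 1\<close> are
  neighbours in the tableau.
\<close>
lemma transpose_Suc_less:
  fixes x y i :: nat
  assumes "x < y" "\<not> (x = i \<and> y = i + 1)"
  shows "transpose i (i + 1) x < transpose i (i + 1) y"
  using assms by (auto simp: transpose_def)

lemma swap_entries_SYT:
  assumes T: "(a, b) \<in> SYT n" and i: "i \<in> set a" "i + 1 \<in> set b"
    and col: "\<And>j. j < n \<Longrightarrow> \<not> (a ! j = i \<and> b ! j = i + 1)"
  shows "swap_entries i (a, b) \<in> SYT n"
proof -
  let ?t = "transpose i (i + 1)"
  have ab: "length a = n" "length b = n" "distinct (a @ b)" "set (a @ b) = {1..2 * n}"
      "sorted_wrt (<) a" "sorted_wrt (<) b" "\<forall>j<n. a ! j < b ! j"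
    using T by (auto simp: SYT_def)
  have row: "sorted_wrt (<) (map ?t xs)"
    if "sorted_wrt (<) xs" "\<not> (i \<in> set xs \<and> i + 1 \<in> set xs)" for xs :: "nat list"
    unfolding sorted_wrt_map
  proof (rule sorted_wrt_mono_rel[OF _ that(1)])
    fix x y assume "x \<in> set xs" "y \<in> set xs" "x < y"
    then show "?t x < ?t y" using that(2) by (intro transpose_Suc_less) auto
  qed
  have "set (map ?t (a @ b)) = ?t ` {1..2 * n}"
    using ab(4) by (simp only: set_map)
  also have "\<dots> = {1..2 * n}"
    using i ab(4) by (intro permutes_image permutes_swap_id) auto
  finally have "set (map ?t a @ map ?t b) = {1..2 * n}" by simp
  moreover have "distinct (map ?t a @ map ?t b)"
    using ab(3) by (simp add: distinct_map flip: map_append)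
  moreover have "sorted_wrt (<) (map ?t a)" "sorted_wrt (<) (map ?t b)"
    using row[OF ab(5)] row[OF ab(6)] i ab(3) by auto
  moreover have "\<forall>j<n. map ?t a ! j < map ?t b ! j"
    using ab col by (auto intro!: transpose_Suc_less[simplified])
  ultimately show ?thesis
    using ab by (simp add: SYT_def swap_entries_def)
qed

lemma SYT_eq_T0:
  assumes T: "(a, b) \<in> SYT n" and a: "\<And>k. k < n \<Longrightarrow> a ! k = 2 * k + 1"
  shows "(a, b) = T0 n"
proof -
  have "a = fst (T0 n)"
    using T a by (auto simp: T0_def SYT_def intro!: nth_equalityI)
  moreover have "b = snd (T0 n)"
  proof (rule strict_sorted_equal)
    show "sorted_wrt (<) b" "sorted_wrt (<) (snd (T0 n))"
      using T T0_in_SYT[of n] by (auto simp: SYT_def)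
    have "set d = {1..2 * n} - set c" if "(c, d) \<in> SYT n" for c d
      using that by (auto simp: SYT_def)
    then show "set b = set (snd (T0 n))"
      using T T0_in_SYT[of n] calculation by (metis prod.collapse)
  qed
  ultimately show ?thesis by simp
qed

text \<open>
  No first-row entry \<open>a ! k\<close> exceeds \<open>2 * k + 1\<close>, its value in \<open>T0\<close>. For the last \<open>k\<close> where
  it is smaller, \<open>i = a ! k\<close> can be swapped with \<open>i + 1\<close>: by maximality \<open>i + 1\<close> is not the next
  entry of the first row, and it is not directly below \<open>i\<close>, since that would leave \<open>a ! k\<close>
  without inversions and so force \<open>a ! k = 2 * k + 1\<close>.
\<close>
lemma ex_arc_into:
  assumes T: "T \<in> SYT n" and ne: "T \<noteq> T0 n"
  shows "\<exists>S i. (S, i, T) \<in> arcs (tableau_graph n)"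
proof -
  obtain a b where T_eq: "T = (a, b)" by (cases T)
  note T' = T[unfolded T_eq]
  have ab: "length a = n" "length b = n" "distinct (a @ b)" "set (a @ b) = {1..2 * n}"
      "sorted_wrt (<) a" "sorted_wrt (<) b"
    using T' by (auto simp: SYT_def)
  define K where "K = {k. k < n \<and> a ! k < 2 * k + 1}"
  define k where "k = Max K"
  have le: "a ! j \<le> 2 * j + 1" if "j < n" for j
    using top_entry_plus_inversions[OF T' that] by linarith
  have "K \<noteq> {}"
    using SYT_eq_T0[OF T'] ne le unfolding T_eq K_def by (auto simp: le_less)
  moreover have "finite K" by (simp add: K_def)
  ultimately have "k \<in> K" and max: "\<And>j. j \<in> K \<Longrightarrow> j \<le> k"
    unfolding k_def by auto
  then have k: "k < n" "a ! k < 2 * k + 1" by (auto simp: K_def)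
  define i where "i = a ! k"
  have ia: "i \<in> set a" using k ab by (simp add: i_def)
  then have i1: "1 \<le> i" using ab(4) by auto
  have "i + 1 \<notin> set a"
  proof
    assume "i + 1 \<in> set a"
    then obtain j where j: "j < n" "a ! j = i + 1" using ab by (auto simp: in_set_conv_nth)
    then have "k < j"
      using SYT_nth_mono(1)[OF T', of j k] k by (force simp: i_def)
    \<comment> \<open>\<open>a ! j = a ! k + 1 \<le> 2 * k + 1 < 2 * j + 1\<close>\<close>
    then have "j \<in> K" using j k by (simp add: K_def i_def)
    then show False using max \<open>k < j\<close> by fastforce
  qed
  moreover have "i + 1 \<in> set (a @ b)"
    using ab(4) k by (auto simp: i_def)
  ultimately have ib: "i + 1 \<in> set b" by simp
  have col: "\<not> (a ! j = i \<and> b ! j = i + 1)" if "j < n" for j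
  proof
    assume j: "a ! j = i \<and> b ! j = i + 1"
    then have "j = k" using ab that k by (auto simp: i_def nth_eq_iff_index_eq)
    then have "b ! k = a ! k + 1" using j by (simp add: i_def)
    then have "{j. j < k \<and> a ! k < b ! j} = {}"
      using ab k by (force simp: sorted_wrt_iff_nth_less)
    then show False
      using top_entry_plus_inversions[OF T' k(1)] k(2) by (metis add_0 card.empty less_irrefl)
  qed
  have "swap_entries i T \<in> SYT n"
    unfolding T_eq by (rule swap_entries_SYT[OF T' ia ib col])
  moreover have "i \<in> {1..<2 * n}" using i1 k by (auto simp: i_def)
  \<comment> \<open>the swap is an involution, so it leads back from \<open>swap_entries i T\<close> to \<open>T\<close>\<close>
  moreover have "swap_entries i (swap_entries i T) = T"
    by (simp add: swap_entries_def T_eq o_def)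
  moreover have "i \<in> set (snd (swap_entries i T))" "i + 1 \<in> set (fst (swap_entries i T))"
    using ia ib by (auto simp: swap_entries_def T_eq image_iff transpose_def)
  ultimately have "(swap_entries i T, i, T) \<in> arcs (tableau_graph n)"
    using T by (simp add: tableau_graph_def)
  then show ?thesis by blast
qed

lemma ex_awalk_from_T0:
  assumes "T \<in> SYT n"
  shows "\<exists>p. pre_digraph.awalk (tableau_graph n) (T0 n) p T"
proof -
  interpret wf_digraph "tableau_graph n" by (rule wf_tableau_graph)
  show ?thesis using assms
  proof (induction "num_inversions (2 * n) (sigma n T)" arbitrary: T rule: less_induct)
    case less
    show ?case
    proof (cases "T = T0 n")
      case True
      then have "awalk (T0 n) [] T"
        using T0_in_SYT by (simp add: awalk_Nil_iff)
      then show ?thesis by blast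
    next
      case False
      with less.prems obtain S i where e: "(S, i, T) \<in> arcs (tableau_graph n)"
        using ex_arc_into by blast
      then have S: "S \<in> SYT n" by (simp add: tableau_graph_def)
      have "num_inversions (2 * n) (sigma n S) < num_inversions (2 * n) (sigma n T)"
        using top_sum_arc[OF e] num_inversions_plus_top_sum[OF S]
          num_inversions_plus_top_sum[OF less.prems] by linarith
      then obtain p where "awalk (T0 n) p S" using less.hyps S by blast
      moreover have "awalk S [(S, i, T)] T"
        using arc_implies_awalk[OF e] by simp
      ultimately show ?thesis using awalk_appendI by blast
    qed
  qed
qed

lemma num_inversions_T0: "num_inversions (2 * n) (sigma n (T0 n)) = 0"
proof -
  have "sum_list (fst (T0 n)) = n\<^sup>2"
    by (induction n) (auto simp: T0_def power2_eq_square)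
  then show ?thesis using num_inversions_plus_top_sum[OF T0_in_SYT[of n]] by simp
qed

theorem corollary3p9:
  fixes n :: nat and T :: tableau
  assumes "n \<ge> 1" and "T \<in> SYT n"
  shows "digraph_dist (tableau_graph n) (T0 n) T = enat (num_inversions (2 * n) (sigma n T))"
proof -
  interpret wf_digraph "tableau_graph n" by (rule wf_tableau_graph)
  let ?d = "num_inversions (2 * n) (sigma n T)"
  have "length p = ?d" if "awalk (T0 n) p T" for p
    using top_sum_awalk[OF that] num_inversions_plus_top_sum[OF assms(2)]
      num_inversions_plus_top_sum[OF T0_in_SYT[of n]] num_inversions_T0[of n] by linarith
  then have len: "length p = ?d" if "apath (T0 n) p T" for p
    using that awalkI_apath by blast
  obtain p where "awalk (T0 n) p T" using ex_awalk_from_T0[OF assms(2)] by blast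
  then have "apath (T0 n) (awalk_to_apath p) T" by (rule apath_awalk_to_apath)
  then have "(\<lambda>p. enat (length p)) ` {p. apath (T0 n) p T} = {enat ?d}"
    using len by (auto simp: image_iff)
  then show ?thesis by (simp add: digraph_dist_def)
qed

end
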